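(* Let $B_L(0,1)=\{\theta\in\mathcal{J}_2 \mid \|\theta\|_L<1\}$ be the unit ball in the norm $\|\cdot\|_L$. Then $$B_L(0,1)=\ker(\phi:\mathcal{J}_2\to\mathcal{A}_2).$$
   Context: $\mathbb{Z}_2$ is the ring of dyadic ($2$-adic) integers, $\mathbb{Q}_2$ its fraction field with dyadic absolute value $|\cdot|_2$. $\mathbb{Z}_2[\xi_1,\dots,\xi_n]$ is graded by $\deg\xi_i=1$. $Jq$ is the $\mathbb{Z}_2$-algebra endomorphism with $Jq(1)=1$, $Jq(\xi_i)=\xi_i+\xi_i^2$. For $k\ge0$, $Jq^k$ is the $\mathbb{Z}_2$-linear map raising degree by $k$ obtained, on each degree $d$, by restricting $Jq$ to degree $d$ and projecting onto degree $d+k$ (extended $\mathbb{Q}_2$-linearly to $\mathbb{Q}_2[\xi_1,\dots,\xi_n]$). The dyadic Steenrod algebra $\mathcal{J}_2$ is the $\mathbb{Z}_2$-algebra generated under composition by the $Jq^k$, $k\ge0$, two elements being equal when they agree as operators on $\mathbb{Z}_2[\xi_1,\dots,\xi_n]$ for every $n$. For $f=\sum_J a_J\xi^J\in\mathbb{Q}_2[\xi_1,\dots,\xi_n]$, $\|f\|_2=\max_J|a_J|_2$. The linear transformation norm of $\theta\in\mathcal{J}_2$ is $\|\theta\|_L=\inf\{c\ge0 : \|\theta(f)\|_2\le c\|f\|_2 \text{ for all } f\in\mathbb{Q}_2[\xi_1,\dots,\xi_n]\ (\text{all } n)\}$. $\mathcal{A}_2$ is the mod $2$ Steenrod algebra generated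 by the Steenrod squares $Sq^k$, acting on the polynomial algebras $\mathbb{F}_2[\xi_1,\dots,\xi_n]$ in the usual way. The ring homomorphism $\phi:\mathcal{J}_2\to\mathcal{A}_2$ is given by $\phi(Jq^k)=Sq^k$ and reduction $\mathbb{Z}_2\to\mathbb{F}_2$ of coefficients. *)

theory Defs
  imports
    Complex_Main
    "HOL-Library.Poly_Mapping"
    "HOL-Library.Z2"
    "HOL-Computational_Algebra.Fraction_Field"
    "HOL-Algebra.RingHom"
begin

section \<open>Dyadic integers and dyadic numbers\<close>

text \<open>The ring \<open>\<int>\<^sub>2\<close> as the inverse limit of the rings \<open>\<int>/2\<^sup>n\<close>: the residue at
  stage \<open>n\<close> is represented by the integer in \<open>{0..<2^n}\<close>.\<close>

typedef dyadic_int = "{x :: nat \<Rightarrow> int. \<forall>n. x n = x (Suc n) mod 2 ^ n}"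
  morphisms residue Abs_dyadic_int
  by (rule exI[of _ "\<lambda>_. 0"]) simp

setup_lifting type_definition_dyadic_int

lemma residue_Suc_mod: "residue x (Suc n) mod 2 ^ n = residue x n"
  by (rule sym, rule spec[OF CollectD[OF residue]])

lemma residue_mod: "residue x n mod 2 ^ n = residue x n"
  using mod_mod_trivial[of "residue x (Suc n)" "2 ^ n"] by (simp only: residue_Suc_mod)

lemma residue_add_mod: "residue x (n + k) mod 2 ^ n = residue x n"
proof (induction k)
  case 0
  show ?case by (simp add: residue_mod)
next
  case (Suc k)
  have "residue x (n + Suc k) mod 2 ^ n = residue x (Suc (n + k)) mod 2 ^ (n + k) mod 2 ^ n"
    by (simp add: mod_mod_cancel le_imp_power_dvd)
  then show ?case using Suc by (simp only: residue_Suc_mod)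
qed

lemma dyadic_int_eqI: "(\<And>n. residue x n = residue y n) \<Longrightarrow> x = y"
  by (simp add: residue_inject[symmetric] fun_eq_iff)

lemma mod_Suc_power: "(a :: int) mod 2 ^ Suc n mod 2 ^ n = a mod 2 ^ n"
  by (simp add: mod_mod_cancel le_imp_power_dvd)

instantiation dyadic_int :: comm_ring_1
begin

lift_definition zero_dyadic_int :: dyadic_int is "\<lambda>_. 0" by simp
lift_definition one_dyadic_int :: dyadic_int is "\<lambda>n. 1 mod 2 ^ n"
  by (simp only: mod_Suc_power simp_thms)
lift_definition plus_dyadic_int :: "dyadic_int \<Rightarrow> dyadic_int \<Rightarrow> dyadic_int"
  is "\<lambda>x y n. (x n + y n) mod 2 ^ n"
proof -
  fix x y :: "nat \<Rightarrow> int" and n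
  assume "\<And>n. x n = x (Suc n) mod 2 ^ n" "\<And>n. y n = y (Suc n) mod 2 ^ n"
  from this[of n] show "(x n + y n) mod 2 ^ n = (x (Suc n) + y (Suc n)) mod 2 ^ Suc n mod 2 ^ n"
    by (simp only: mod_Suc_power mod_add_eq)
qed
lift_definition minus_dyadic_int :: "dyadic_int \<Rightarrow> dyadic_int \<Rightarrow> dyadic_int"
  is "\<lambda>x y n. (x n - y n) mod 2 ^ n"
proof -
  fix x y :: "nat \<Rightarrow> int" and n
  assume "\<And>n. x n = x (Suc n) mod 2 ^ n" "\<And>n. y n = y (Suc n) mod 2 ^ n"
  from this[of n] show "(x n - y n) mod 2 ^ n = (x (Suc n) - y (Suc n)) mod 2 ^ Suc n mod 2 ^ n"
    by (simp only: mod_Suc_power mod_diff_eq)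
qed
lift_definition uminus_dyadic_int :: "dyadic_int \<Rightarrow> dyadic_int"
  is "\<lambda>x n. (- x n) mod 2 ^ n"
proof -
  fix x :: "nat \<Rightarrow> int" and n
  assume "\<And>n. x n = x (Suc n) mod 2 ^ n"
  from this[of n] show "(- x n) mod 2 ^ n = (- x (Suc n)) mod 2 ^ Suc n mod 2 ^ n"
    by (simp only: mod_Suc_power mod_minus_eq)
qed
lift_definition times_dyadic_int :: "dyadic_int \<Rightarrow> dyadic_int \<Rightarrow> dyadic_int"
  is "\<lambda>x y n. (x n * y n) mod 2 ^ n"
proof -
  fix x y :: "nat \<Rightarrow> int" and n
  assume "\<And>n. x n = x (Suc n) mod 2 ^ n" "\<And>n. y n = y (Suc n) mod 2 ^ n"
  from this[of n] show "(x n * y n) mod 2 ^ n = (x (Suc n) * y (Suc n)) mod 2 ^ Suc n mod 2 ^ n"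
    by (simp only: mod_Suc_power mod_mult_eq)
qed

instance
proof
  fix a b c :: dyadic_int
  have m: "residue x n mod 2 ^ n = residue x n" for x n by (rule residue_mod)
  show "a * b * c = a * (b * c)"
    by (rule dyadic_int_eqI) (simp add: times_dyadic_int.rep_eq mod_simps mult.assoc)
  show "a * b = b * a"
    by (rule dyadic_int_eqI) (simp add: times_dyadic_int.rep_eq mult.commute)
  show "1 * a = a"
    by (rule dyadic_int_eqI)
       (simp only: times_dyadic_int.rep_eq one_dyadic_int.rep_eq mod_mult_left_eq mult_1_left m)
  show "a + b + c = a + (b + c)"
    by (rule dyadic_int_eqI) (simp add: plus_dyadic_int.rep_eq mod_simps add.assoc)
  show "a + b = b + a"
    by (rule dyadic_int_eqI) (simp add: plus_dyadic_int.rep_eq add.commute)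
  show "0 + a = a"
    by (rule dyadic_int_eqI) (simp add: plus_dyadic_int.rep_eq zero_dyadic_int.rep_eq m)
  show "- a + a = 0"
    by (rule dyadic_int_eqI)
       (simp add: plus_dyadic_int.rep_eq zero_dyadic_int.rep_eq uminus_dyadic_int.rep_eq mod_simps)
  show "a - b = a + - b"
    by (rule dyadic_int_eqI)
       (simp add: plus_dyadic_int.rep_eq minus_dyadic_int.rep_eq uminus_dyadic_int.rep_eq mod_simps)
  show "(a + b) * c = a * c + b * c"
    by (rule dyadic_int_eqI)
       (simp add: plus_dyadic_int.rep_eq times_dyadic_int.rep_eq mod_simps distrib_right)
  have "residue 0 1 \<noteq> residue 1 1"
    by (simp add: zero_dyadic_int.rep_eq one_dyadic_int.rep_eq)
  then show "(0 :: dyadic_int) \<noteq> 1" by metis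
qed

end

lemma residue_0_iff: "residue x n = 0 \<longleftrightarrow> 2 ^ n dvd residue x (n + k)"
  by (metis residue_add_mod dvd_eq_mod_eq_0)

lemma two_power_dvd_mult:
  fixes u w :: int
  assumes "2 ^ (a + b) dvd u * w"
  shows "2 ^ a dvd u \<or> 2 ^ b dvd w"
  using assms
proof (induction "a + b" arbitrary: a b u w)
  case 0
  then show ?case by simp
next
  case (Suc k)
  show ?case
  proof (cases "a = 0 \<or> b = 0")
    case True
    then show ?thesis by auto
  next
    case False
    then obtain a' b' where ab: "a = Suc a'" "b = Suc b'" by (metis not0_implies_Suc)
    have "2 dvd u * w"
      using Suc.prems dvd_mult_left[of 2 "2 ^ (a' + b)" "u * w"] by (simp add: ab)
    then consider u' where "u = 2 * u'" | w' where "w = 2 * w'"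
      unfolding even_mult_iff by (auto elim: evenE)
    then show ?thesis
    proof cases
      case 1
      have "2 * 2 ^ (a' + b) dvd 2 * (u' * w)"
        using Suc.prems by (simp add: ab(1) 1 mult.assoc)
      then have "2 ^ (a' + b) dvd u' * w" by (simp only: dvd_mult_cancel_left) simp
      with Suc.hyps ab(1) have "2 ^ a' dvd u' \<or> 2 ^ b dvd w" by simp
      then show ?thesis unfolding ab(1) 1 by auto
    next
      case 2
      have "2 * 2 ^ (a + b') dvd 2 * (u * w')"
        using Suc.prems by (simp add: ab(2) 2 mult.left_commute)
      then have "2 ^ (a + b') dvd u * w'" by (simp only: dvd_mult_cancel_left) simp
      with Suc.hyps ab(2) have "2 ^ a dvd u \<or> 2 ^ b' dvd w'" by simp
      then show ?thesis unfolding ab(2) 2 by auto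
    qed
  qed
qed

lemma dyadic_int_eq_0_iff: "x = 0 \<longleftrightarrow> (\<forall>n. residue x n = 0)"
  by (auto simp: zero_dyadic_int.rep_eq intro: dyadic_int_eqI)

instance dyadic_int :: idom
proof
  fix x y :: dyadic_int
  assume "x \<noteq> 0" "y \<noteq> 0"
  then obtain a b where a: "residue x a \<noteq> 0" and b: "residue y b \<noteq> 0"
    by (auto simp: dyadic_int_eq_0_iff)
  show "x * y \<noteq> 0"
  proof
    assume "x * y = 0"
    then have "residue (x * y) (a + b) = 0" by (simp add: zero_dyadic_int.rep_eq)
    then have "2 ^ (a + b) dvd residue x (a + b) * residue y (b + a)"
      by (simp add: times_dyadic_int.rep_eq dvd_eq_mod_eq_0 add.commute)
    then show False
      using two_power_dvd_mult residue_0_iff a b by blast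
  qed
qed

lemma residue_mult: "residue (x * y) n = residue x n * residue y n mod 2 ^ n"
  by (simp add: times_dyadic_int.rep_eq)

lemma residue_two_power: "residue (2 ^ k) n = 2 ^ k mod 2 ^ n"
proof (induction k)
  case 0
  show ?case by (simp add: one_dyadic_int.rep_eq)
next
  case (Suc k)
  have two: "residue 2 n = 2 mod 2 ^ n"
    using plus_dyadic_int.rep_eq[of 1 1]
    by (simp only: one_add_one one_dyadic_int.rep_eq mod_add_eq)
  show ?case
    by (simp only: power_Suc residue_mult Suc two mod_mult_eq)
qed

lemma two_power_dvd_imp_residue_0: "2 ^ n dvd x \<Longrightarrow> residue x n = 0"
  by (auto simp: dvd_def residue_mult residue_two_power)

lemma two_dvd_iff: "2 dvd x \<longleftrightarrow> residue x 1 = 0"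
proof
  assume "2 dvd x"
  then show "residue x 1 = 0" using two_power_dvd_imp_residue_0[of 1 x] by simp
next
  assume "residue x 1 = 0"
  then have "2 dvd residue x (Suc n)" for n
    using residue_0_iff[of x 1 n] by simp
  then have ev: "residue x (Suc n) = 2 * (residue x (Suc n) div 2)" for n
    by simp
  define y where "y = Abs_dyadic_int (\<lambda>n. residue x (Suc n) div 2)"
  have "residue x (Suc n) div 2 = residue x (Suc (Suc n)) div 2 mod 2 ^ n" for n
  proof -
    have "residue x (Suc n) = residue x (Suc (Suc n)) mod (2 * 2 ^ n)"
      using residue_Suc_mod[of x "Suc n"] by simp
    also have "\<dots> = 2 * (residue x (Suc (Suc n)) div 2) mod (2 * 2 ^ n)"
      using ev[of "Suc n"] by simp
    also have "\<dots> = 2 * (residue x (Suc (Suc n)) div 2 mod 2 ^ n)"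
      by (simp only: mod_mult_mult1)
    finally show ?thesis by linarith
  qed
  then have "(\<lambda>n. residue x (Suc n) div 2) \<in> {z. \<forall>n. z n = z (Suc n) mod 2 ^ n}"
    by (intro CollectI allI)
  then have y: "residue y n = residue x (Suc n) div 2" for n
    unfolding y_def by (rule Abs_dyadic_int_inverse[THEN fun_cong])
  have "x = 2 * y"
  proof (rule dyadic_int_eqI)
    fix n
    have "residue (2 * y) n = 2 * (residue x (Suc n) div 2) mod 2 ^ n"
      unfolding residue_mult y residue_two_power[of 1 n, simplified] by (simp only: mod_mult_left_eq)
    also have "\<dots> = residue x (Suc n) mod 2 ^ n" using ev[of n] by simp
    finally show "residue x n = residue (2 * y) n" by (simp only: residue_Suc_mod)
  qed
  then show "2 dvd x" by simp
qed

lemma two_nonzero: "(2 :: dyadic_int) \<noteq> 0"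
proof
  assume "(2 :: dyadic_int) = 0"
  then have "residue 2 2 = 0" by (simp add: zero_dyadic_int.rep_eq)
  then show False using residue_two_power[of 1 2] by simp
qed

lemma two_dvd_mult: "2 dvd x * y \<longleftrightarrow> 2 dvd x \<or> 2 dvd (y :: dyadic_int)"
proof -
  have *: "residue z 1 = 0 \<or> residue z 1 = 1" for z
    using mod2_eq_if[of "residue z 1"] residue_mod[of z 1] by (simp split: if_splits)
  show ?thesis
    using *[of x] *[of y] unfolding two_dvd_iff residue_mult by (elim disjE) simp_all
qed

definition dyadic_val :: "dyadic_int \<Rightarrow> nat"
  where "dyadic_val x = (GREATEST n. 2 ^ n dvd x)"

lemma dyadic_val_eqI:
  assumes "\<not> 2 dvd u"
  shows "dyadic_val (2 ^ n * u) = n"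
  unfolding dyadic_val_def
proof (rule Greatest_equality)
  fix k :: nat
  assume d: "2 ^ k dvd 2 ^ n * u"
  show "k \<le> n"
  proof (rule ccontr)
    assume "\<not> k \<le> n"
    then have "2 ^ Suc n dvd 2 ^ n * u" using d by (meson dvd_trans le_imp_power_dvd not_less_eq_eq)
    then have "2 ^ n * 2 dvd 2 ^ n * u" by (simp only: power_Suc mult.commute)
    then show False using assms two_nonzero by (simp only: dvd_mult_cancel_left) simp
  qed
qed simp

lemma dyadic_int_decomp:
  assumes "x \<noteq> 0"
  shows "\<exists>u. x = 2 ^ dyadic_val x * u \<and> \<not> 2 dvd u"
proof -
  obtain n where n: "residue x n \<noteq> 0" using assms by (auto simp: dyadic_int_eq_0_iff)
  have "\<exists>k u. x = 2 ^ k * u \<and> \<not> 2 dvd u"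
  proof (rule ccontr)
    assume H: "\<nexists>k u. x = 2 ^ k * u \<and> \<not> 2 dvd u"
    have "2 ^ k dvd x" for k
    proof (induction k)
      case (Suc k)
      then obtain u where u: "x = 2 ^ k * u" by (rule dvdE)
      with H have "2 dvd u" by blast
      then obtain w where "u = 2 * w" by (rule dvdE)
      then have "x = 2 ^ Suc k * w" using u by (simp add: mult_ac)
      then show ?case by (rule dvdI)
    qed simp
    then show False using n two_power_dvd_imp_residue_0 by blast
  qed
  then obtain k u where u: "x = 2 ^ k * u" "\<not> 2 dvd u" by blast
  have "dyadic_val x = k" unfolding u(1) using u(2) by (rule dyadic_val_eqI)
  then show ?thesis using u by (intro exI[of _ u]) (simp only: simp_thms)
qed

lemma dyadic_val_mult:
  assumes "x \<noteq> 0" "y \<noteq> 0"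
  shows "dyadic_val (x * y) = dyadic_val x + dyadic_val y"
proof -
  obtain u where u: "x = 2 ^ dyadic_val x * u" "\<not> 2 dvd u"
    using dyadic_int_decomp[OF assms(1)] by (elim exE conjE)
  obtain w where w: "y = 2 ^ dyadic_val y * w" "\<not> 2 dvd w"
    using dyadic_int_decomp[OF assms(2)] by (elim exE conjE)
  have "x * y = (2 ^ dyadic_val x * u) * (2 ^ dyadic_val y * w)"
    by (rule arg_cong2[of _ _ _ _ times, OF u(1) w(1)])
  also have "\<dots> = 2 ^ (dyadic_val x + dyadic_val y) * (u * w)"
    by (simp only: power_add mult_ac)
  finally have "dyadic_val (x * y) = dyadic_val (2 ^ (dyadic_val x + dyadic_val y) * (u * w))"
    by (rule arg_cong)
  also have "\<dots> = dyadic_val x + dyadic_val y"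
    by (rule dyadic_val_eqI) (simp add: two_dvd_mult u(2) w(2))
  finally show ?thesis .
qed

definition dyadic_int_abs :: "dyadic_int \<Rightarrow> real"
  where "dyadic_int_abs x = (if x = 0 then 0 else (1 / 2) ^ dyadic_val x)"

lemma dyadic_int_abs_mult: "dyadic_int_abs (x * y) = dyadic_int_abs x * dyadic_int_abs y"
  by (simp add: dyadic_int_abs_def dyadic_val_mult power_add)

lemma dyadic_int_abs_eq_0_iff: "dyadic_int_abs x = 0 \<longleftrightarrow> x = 0"
  by (simp add: dyadic_int_abs_def)

type_synonym dyadic = "dyadic_int fract"

lift_definition dyadic_abs :: "dyadic \<Rightarrow> real"
  is "\<lambda>(a, b). dyadic_int_abs a / dyadic_int_abs b"
proof -
  fix p q :: "dyadic_int \<times> dyadic_int"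
  assume *: "fractrel p q"
  have "dyadic_int_abs (fst p) * dyadic_int_abs (snd q) = dyadic_int_abs (fst q) * dyadic_int_abs (snd p)"
    using * by (simp flip: dyadic_int_abs_mult)
  then show "(case p of (a, b) \<Rightarrow> dyadic_int_abs a / dyadic_int_abs b) =
      (case q of (a, b) \<Rightarrow> dyadic_int_abs a / dyadic_int_abs b)"
    using * by (simp add: case_prod_beta frac_eq_eq dyadic_int_abs_eq_0_iff)
qed

lemma dyadic_abs_Fract:
  "b \<noteq> 0 \<Longrightarrow> dyadic_abs (Fraction_Field.Fract a b) = dyadic_int_abs a / dyadic_int_abs b"
  by transfer simp

section \<open>Polynomials\<close>

text \<open>\<open>'a mpoly\<close> is the ring \<open>'a[\<xi>\<^sub>0, \<xi>\<^sub>1, \<dots>]\<close>, the increasing union of the polynomial rings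
  \<open>mpoly_vars n\<close> in the first \<open>n\<close> variables.\<close>

type_synonym 'a mpoly = "(nat \<Rightarrow>\<^sub>0 nat) \<Rightarrow>\<^sub>0 'a"

definition mpoly_vars :: "nat \<Rightarrow> 'a::zero mpoly set"
  where "mpoly_vars n = {f. \<forall>m\<in>Poly_Mapping.keys f. Poly_Mapping.keys m \<subseteq> {..<n}}"

definition cst :: "'a \<Rightarrow> 'a::comm_ring_1 mpoly"
  where "cst c = Poly_Mapping.single 0 c"

definition xi :: "nat \<Rightarrow> 'a::comm_ring_1 mpoly"
  where "xi i = Poly_Mapping.single (Poly_Mapping.single i 1) 1"

definition mono_deg :: "(nat \<Rightarrow>\<^sub>0 nat) \<Rightarrow> nat"
  where "mono_deg m = (\<Sum>i\<in>Poly_Mapping.keys m. Poly_Mapping.lookup m i)"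

definition hom_part :: "nat \<Rightarrow> 'a::comm_ring_1 mpoly \<Rightarrow> 'a mpoly"
  where "hom_part d f =
    (\<Sum>m | m \<in> Poly_Mapping.keys f \<and> mono_deg m = d.
      Poly_Mapping.single m (Poly_Mapping.lookup f m))"

section \<open>Squaring operations\<close>

text \<open>The constructions are the same over \<open>\<int>\<^sub>2\<close>, where they give the operations \<open>Jq\<close>, and over
  \<open>\<bbbF>\<^sub>2\<close>, where they give the Steenrod squares. The total square substitutes \<open>\<xi>\<^sub>i + \<xi>\<^sub>i\<^sup>2\<close>
  for \<open>\<xi>\<^sub>i\<close>; the lemmas below characterise it as the algebra endomorphism with these values.\<close>

definition sq_mono :: "(nat \<Rightarrow>\<^sub>0 nat) \<Rightarrow> 'a::comm_ring_1 mpoly"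
  where "sq_mono m = (\<Prod>i\<in>Poly_Mapping.keys m. (xi i + xi i ^ 2) ^ Poly_Mapping.lookup m i)"

definition total_sq :: "'a::comm_ring_1 mpoly \<Rightarrow> 'a mpoly"
  where "total_sq f = (\<Sum>m\<in>Poly_Mapping.keys f. cst (Poly_Mapping.lookup f m) * sq_mono m)"

definition sq :: "nat \<Rightarrow> 'a::comm_ring_1 mpoly \<Rightarrow> 'a mpoly"
  where "sq k f =
    (\<Sum>d \<in> mono_deg ` Poly_Mapping.keys f. hom_part (d + k) (total_sq (hom_part d f)))"

definition Jq :: "nat \<Rightarrow> dyadic_int mpoly \<Rightarrow> dyadic_int mpoly"
  where "Jq = sq"

definition Sq :: "nat \<Rightarrow> bit mpoly \<Rightarrow> bit mpoly"
  where "Sq = sq"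

lemma keys_single_subset: "Poly_Mapping.keys (Poly_Mapping.single m c) \<subseteq> {m}"
  by simp

lemma poly_as_sum:
  "f = (\<Sum>m\<in>Poly_Mapping.keys f. Poly_Mapping.single m (Poly_Mapping.lookup f m))"
  by (rule poly_mapping_eqI)
     (auto simp: lookup_sum lookup_single when_def in_keys_iff sum.delta')

lemma cst_0 [simp]: "cst 0 = 0" by (simp add: cst_def)
lemma cst_1 [simp]: "cst 1 = 1" by (simp add: cst_def)
lemma cst_add: "cst (a + b) = cst a + cst b" by (simp add: cst_def single_add)
lemma cst_mult: "cst (a * b) = cst a * cst b" by (simp add: cst_def mult_single)
lemma cst_minus: "cst (- a) = - cst a" by (simp add: cst_def single_uminus)
lemma lookup_cst_mult: "Poly_Mapping.lookup (cst c * f) m = c * Poly_Mapping.lookup f m"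
  unfolding cst_def mult_map_scale_conv_mult[symmetric]
  by (simp add: Poly_Mapping.map.rep_eq when_def)

lemma single_add_key: "Poly_Mapping.single (m + n) (a * b) = Poly_Mapping.single m a * Poly_Mapping.single n b"
  by (simp add: mult_single)

lemma sum_keys_superset:
  assumes "finite S" "Poly_Mapping.keys f \<subseteq> S"
  shows "total_sq f = (\<Sum>m\<in>S. cst (Poly_Mapping.lookup f m) * sq_mono m)"
  unfolding total_sq_def using assms
  by (intro sum.mono_neutral_left) (auto simp: in_keys_iff)

lemma total_sq_add: "total_sq (f + g) = total_sq f + total_sq g"
proof -
  let ?S = "Poly_Mapping.keys f \<union> Poly_Mapping.keys g"
  have S: "finite ?S" "Poly_Mapping.keys (f + g) \<subseteq> ?S" "Poly_Mapping.keys f \<subseteq> ?S" "Poly_Mapping.keys g \<subseteq> ?S"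
    using keys_add[of f g] by auto
  show ?thesis
    unfolding sum_keys_superset[OF S(1,2)] sum_keys_superset[OF S(1,3)] sum_keys_superset[OF S(1,4)]
    by (simp add: lookup_add cst_add distrib_right sum.distrib)
qed

lemma total_sq_0 [simp]: "total_sq 0 = 0"
  by (simp add: total_sq_def)

lemma total_sq_sum: "total_sq (\<Sum>x\<in>A. F x) = (\<Sum>x\<in>A. total_sq (F x))"
  by (induction A rule: infinite_finite_induct) (auto simp: total_sq_add)

lemma total_sq_single: "total_sq (Poly_Mapping.single m c) = cst c * sq_mono m"
  using sum_keys_superset[OF _ keys_single_subset, of m c] by simp

lemma sq_mono_superset:
  assumes "finite S" "Poly_Mapping.keys m \<subseteq> S"
  shows "sq_mono m = (\<Prod>i\<in>S. (xi i + xi i ^ 2) ^ Poly_Mapping.lookup m i)"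
  unfolding sq_mono_def using assms
  by (intro prod.mono_neutral_left) (auto simp: in_keys_iff)

lemma sq_mono_add: "sq_mono (m + n) = sq_mono m * sq_mono n"
proof -
  let ?S = "Poly_Mapping.keys m \<union> Poly_Mapping.keys n"
  have S: "finite ?S" "Poly_Mapping.keys (m + n) \<subseteq> ?S" "Poly_Mapping.keys m \<subseteq> ?S" "Poly_Mapping.keys n \<subseteq> ?S"
    using keys_add[of m n] by auto
  show ?thesis
    unfolding sq_mono_superset[OF S(1,2)] sq_mono_superset[OF S(1,3)] sq_mono_superset[OF S(1,4)]
    by (simp add: lookup_add power_add prod.distrib)
qed

lemma total_sq_mult: "total_sq (f * g) = total_sq f * total_sq g"
proof -
  have "f * g = (\<Sum>m\<in>Poly_Mapping.keys f. \<Sum>n\<in>Poly_Mapping.keys g.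
      Poly_Mapping.single (m + n) (Poly_Mapping.lookup f m * Poly_Mapping.lookup g n))"
    by (subst poly_as_sum[of f], subst poly_as_sum[of g])
       (simp add: sum_product mult_single)
  then have "total_sq (f * g) = (\<Sum>m\<in>Poly_Mapping.keys f. \<Sum>n\<in>Poly_Mapping.keys g.
      cst (Poly_Mapping.lookup f m * Poly_Mapping.lookup g n) * sq_mono (m + n))"
    by (simp only: total_sq_sum total_sq_single)
  also have "\<dots> = total_sq f * total_sq g"
    unfolding total_sq_def sum_product sq_mono_add cst_mult by (simp only: mult_ac)
  finally show ?thesis .
qed

lemma total_sq_cst: "total_sq (cst c) = cst c"
  unfolding cst_def total_sq_single by (simp add: sq_mono_def cst_def)

lemma total_sq_1: "total_sq 1 = 1"
  using total_sq_cst[of 1] by simp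

lemma total_sq_xi: "total_sq (xi i) = xi i + xi i ^ 2"
  unfolding xi_def total_sq_single by (simp add: sq_mono_def xi_def)

lemma lookup_hom_part:
  "Poly_Mapping.lookup (hom_part d f) m = (if mono_deg m = d then Poly_Mapping.lookup f m else 0)"
  unfolding hom_part_def
  by (auto simp: lookup_sum lookup_single when_def in_keys_iff sum.delta')

lemma hom_part_add: "hom_part d (f + g) = hom_part d f + hom_part d g"
  by (rule poly_mapping_eqI) (simp add: lookup_hom_part lookup_add)

lemma hom_part_cst_mult: "hom_part d (cst c * f) = cst c * hom_part d f"
  by (rule poly_mapping_eqI) (simp add: lookup_hom_part lookup_cst_mult)

lemma hom_part_0 [simp]: "hom_part d 0 = 0"
  by (rule poly_mapping_eqI) (simp add: lookup_hom_part)

lemma hom_part_eq_0: "d \<notin> mono_deg ` Poly_Mapping.keys f \<Longrightarrow> hom_part d f = 0"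
  by (rule poly_mapping_eqI) (auto simp: lookup_hom_part in_keys_iff)

lemma sq_superset:
  assumes "finite D" "mono_deg ` Poly_Mapping.keys f \<subseteq> D"
  shows "sq k f = (\<Sum>d\<in>D. hom_part (d + k) (total_sq (hom_part d f)))"
  unfolding sq_def using assms
  by (intro sum.mono_neutral_left) (auto simp: hom_part_eq_0)

lemma sq_add: "sq k (f + g) = sq k f + sq k g"
proof -
  let ?D = "mono_deg ` Poly_Mapping.keys f \<union> mono_deg ` Poly_Mapping.keys g"
  have D: "finite ?D" "mono_deg ` Poly_Mapping.keys (f + g) \<subseteq> ?D"
      "mono_deg ` Poly_Mapping.keys f \<subseteq> ?D" "mono_deg ` Poly_Mapping.keys g \<subseteq> ?D"
    using keys_add[of f g] by auto
  show ?thesis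
    unfolding sq_superset[OF D(1,2)] sq_superset[OF D(1,3)] sq_superset[OF D(1,4)]
    by (simp add: hom_part_add total_sq_add sum.distrib)
qed

lemma sq_homogeneous:
  assumes "\<forall>m\<in>Poly_Mapping.keys f. mono_deg m = d"
  shows "sq k f = hom_part (d + k) (total_sq f)"
proof -
  have "hom_part d f = f"
    using assms by (intro poly_mapping_eqI) (auto simp: lookup_hom_part in_keys_iff)
  then show ?thesis using sq_superset[of "{d}" f k] assms by auto
qed

lemma sq_cst_mult: "sq k (cst c * f) = cst c * sq k f"
proof -
  have "mono_deg ` Poly_Mapping.keys (cst c * f) \<subseteq> mono_deg ` Poly_Mapping.keys f"
    by (intro image_mono subsetI) (auto simp: in_keys_iff lookup_cst_mult)
  then have "sq k (cst c * f) =
      (\<Sum>d\<in>mono_deg ` Poly_Mapping.keys f. hom_part (d + k) (total_sq (hom_part d (cst c * f))))"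
    by (intro sq_superset) auto
  then show ?thesis
    by (simp add: sq_def hom_part_cst_mult total_sq_mult total_sq_cst sum_distrib_left)
qed

section \<open>The algebras generated by the squaring operations\<close>

inductive_set sq_ops :: "('a::comm_ring_1 mpoly \<Rightarrow> 'a mpoly) set"
  where
    sq: "sq k \<in> sq_ops"
  | one: "(\<lambda>f. f) \<in> sq_ops"
  | scale: "\<theta> \<in> sq_ops \<Longrightarrow> (\<lambda>f. cst c * \<theta> f) \<in> sq_ops"
  | add: "\<theta> \<in> sq_ops \<Longrightarrow> \<psi> \<in> sq_ops \<Longrightarrow> (\<lambda>f. \<theta> f + \<psi> f) \<in> sq_ops"
  | comp: "\<theta> \<in> sq_ops \<Longrightarrow> \<psi> \<in> sq_ops \<Longrightarrow> (\<lambda>f. \<theta> (\<psi> f)) \<in> sq_ops"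

definition sq_algebra :: "('a::comm_ring_1 mpoly \<Rightarrow> 'a mpoly) ring"
  where "sq_algebra =
    \<lparr>carrier = sq_ops, mult = (\<lambda>\<theta> \<psi> f. \<theta> (\<psi> f)), one = (\<lambda>f. f),
     zero = (\<lambda>f. 0), add = (\<lambda>\<theta> \<psi> f. \<theta> f + \<psi> f)\<rparr>"

text \<open>Both \<open>J2\<close> and the mod 2 Steenrod algebra \<open>A2\<close> are algebras of operators on the polynomial
  rings in \<open>n\<close> variables for all \<open>n\<close>, on which \<open>A2\<close> acts faithfully. Operators are taken on the union of the polynomial rings in \<open>n\<close> variables. They restrict to
  each of these rings, and they are equal if and only if all the restrictions are, by
  \<open>sq_ops_mpoly_vars\<close> and \<open>sq_ops_eq_iff\<close> below.\<close>

definition J2 :: "(dyadic_int mpoly \<Rightarrow> dyadic_int mpoly) ring"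
  where "J2 = sq_algebra"

definition A2 :: "(bit mpoly \<Rightarrow> bit mpoly) ring"
  where "A2 = sq_algebra"

lemma mpoly_vars_add: "f \<in> mpoly_vars n \<Longrightarrow> g \<in> mpoly_vars n \<Longrightarrow> f + g \<in> mpoly_vars n"
  using keys_add[of f g] unfolding mpoly_vars_def by blast

lemma mpoly_vars_0: "0 \<in> mpoly_vars n"
  by (simp add: mpoly_vars_def)

lemma mpoly_vars_sum: "(\<And>x. x \<in> A \<Longrightarrow> F x \<in> mpoly_vars n) \<Longrightarrow> sum F A \<in> mpoly_vars n"
  by (induction A rule: infinite_finite_induct) (auto simp: mpoly_vars_0 mpoly_vars_add)

lemma mpoly_vars_mult:
  assumes "f \<in> mpoly_vars n" "g \<in> mpoly_vars n"
  shows "f * g \<in> mpoly_vars n"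
  unfolding mpoly_vars_def
proof (intro CollectI ballI)
  fix m
  assume "m \<in> Poly_Mapping.keys (f * g)"
  then obtain a b where "a \<in> Poly_Mapping.keys f" "b \<in> Poly_Mapping.keys g" "m = a + b"
    using keys_mult[of f g] by blast
  with assms show "Poly_Mapping.keys m \<subseteq> {..<n}"
    using keys_add[of a b] unfolding mpoly_vars_def by blast
qed

lemma mpoly_vars_cst: "cst c \<in> mpoly_vars n"
  by (auto simp: mpoly_vars_def cst_def)

lemma mpoly_vars_1: "1 \<in> mpoly_vars n"
  by (auto simp: mpoly_vars_def)

lemma mpoly_vars_xi: "i < n \<Longrightarrow> xi i \<in> mpoly_vars n"
  by (auto simp: mpoly_vars_def xi_def)

lemma mpoly_vars_power: "f \<in> mpoly_vars n \<Longrightarrow> f ^ k \<in> mpoly_vars n"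
  by (induction k) (auto simp: mpoly_vars_1 mpoly_vars_mult)

lemma mpoly_vars_prod: "(\<And>x. x \<in> A \<Longrightarrow> F x \<in> mpoly_vars n) \<Longrightarrow> prod F A \<in> mpoly_vars n"
  by (induction A rule: infinite_finite_induct) (auto simp: mpoly_vars_1 mpoly_vars_mult)

lemma mpoly_vars_hom_part: "f \<in> mpoly_vars n \<Longrightarrow> hom_part d f \<in> mpoly_vars n"
  by (auto simp: mpoly_vars_def in_keys_iff lookup_hom_part split: if_splits)

lemma mpoly_vars_total_sq: "f \<in> mpoly_vars n \<Longrightarrow> total_sq f \<in> mpoly_vars n"
  unfolding total_sq_def sq_mono_def
  by (intro mpoly_vars_sum mpoly_vars_mult mpoly_vars_cst mpoly_vars_prod mpoly_vars_power
        mpoly_vars_add mpoly_vars_xi) (auto simp: mpoly_vars_def)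

lemma sq_ops_mpoly_vars: "\<theta> \<in> sq_ops \<Longrightarrow> f \<in> mpoly_vars n \<Longrightarrow> \<theta> f \<in> mpoly_vars n"
proof (induction \<theta> arbitrary: f rule: sq_ops.induct)
  case (sq k)
  then show ?case
    unfolding sq_def by (intro mpoly_vars_sum mpoly_vars_hom_part mpoly_vars_total_sq)
qed (auto intro: mpoly_vars_mult mpoly_vars_add mpoly_vars_cst)

lemma mpoly_vars_exhaust: "\<exists>n. f \<in> mpoly_vars n"
proof -
  have "finite (\<Union>m\<in>Poly_Mapping.keys f. Poly_Mapping.keys m)" by simp
  then obtain n where "(\<Union>m\<in>Poly_Mapping.keys f. Poly_Mapping.keys m) \<subseteq> {..<n}"
    by (auto simp: finite_nat_set_iff_bounded)
  then show ?thesis unfolding mpoly_vars_def by blast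
qed

lemma sq_ops_eq_iff: "\<theta> = \<psi> \<longleftrightarrow> (\<forall>n. \<forall>f\<in>mpoly_vars n. \<theta> f = \<psi> f)"
  using mpoly_vars_exhaust by blast

lemma sq_ops_add: "\<theta> \<in> sq_ops \<Longrightarrow> \<theta> (f + g) = \<theta> f + \<theta> g"
  by (induction \<theta> arbitrary: f g rule: sq_ops.induct)
     (simp_all add: sq_add distrib_left add_ac)

lemma sq_ops_cst_mult: "\<theta> \<in> sq_ops \<Longrightarrow> \<theta> (cst c * f) = cst c * \<theta> f"
  by (induction \<theta> arbitrary: f rule: sq_ops.induct)
     (simp_all add: sq_cst_mult distrib_left mult.left_commute[of _ "cst c"])

lemma ring_sq_algebra: "ring (sq_algebra :: ('a::comm_ring_1 mpoly \<Rightarrow> 'a mpoly) ring)"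
proof -
  let ?R = "sq_algebra :: ('a mpoly \<Rightarrow> 'a mpoly) ring"
  have "(\<lambda>f. cst 0 * f) \<in> (sq_ops :: ('a mpoly \<Rightarrow> 'a mpoly) set)"
    by (intro sq_ops.scale sq_ops.one)
  then have zero: "(\<lambda>f. 0) \<in> (sq_ops :: ('a mpoly \<Rightarrow> 'a mpoly) set)" by simp
  have neg: "\<exists>\<psi>\<in>sq_ops. (\<lambda>f. \<theta> f + \<psi> f) = (\<lambda>f. 0)"
    if "\<theta> \<in> (sq_ops :: ('a mpoly \<Rightarrow> 'a mpoly) set)" for \<theta>
    using sq_ops.scale[OF that, of "- 1"] by (rule rev_bexI) (simp add: cst_minus)
  have "abelian_group ?R"
    by (rule abelian_groupI)
       (auto simp: sq_algebra_def add_ac zero neg intro: sq_ops.intros)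
  moreover have "monoid ?R"
    by (rule monoidI) (auto simp: sq_algebra_def intro: sq_ops.intros)
  ultimately show ?thesis
    by (rule ringI) (auto simp: sq_algebra_def sq_ops_add)
qed

section \<open>The linear transformation norm\<close>

definition gauss_norm :: "dyadic mpoly \<Rightarrow> real"
  where "gauss_norm f =
    Max (insert 0 ((\<lambda>m. dyadic_abs (Poly_Mapping.lookup f m)) ` Poly_Mapping.keys f))"

definition to_dyadic :: "dyadic_int mpoly \<Rightarrow> dyadic mpoly"
  where "to_dyadic f = Poly_Mapping.map (\<lambda>a. Fraction_Field.Fract a 1) f"

text \<open>The \<open>\<rat>\<^sub>2\<close>-linear extension of a \<open>\<int>\<^sub>2\<close>-linear operator, written on the monomial basis.\<close>

definition extend :: "(dyadic_int mpoly \<Rightarrow> dyadic_int mpoly) \<Rightarrow> dyadic mpoly \<Rightarrow> dyadic mpoly"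
  where "extend \<theta> f =
    (\<Sum>m\<in>Poly_Mapping.keys f.
      cst (Poly_Mapping.lookup f m) * to_dyadic (\<theta> (Poly_Mapping.single m 1)))"

text \<open>The infimum is over a nonempty set of reals for \<open>\<theta> \<in> carrier J2\<close>: as \<open>\<theta>\<close> preserves
  integrality, the set contains \<open>1\<close>.\<close>

definition norm_L :: "(dyadic_int mpoly \<Rightarrow> dyadic_int mpoly) \<Rightarrow> real"
  where "norm_L \<theta> =
    Inf {c. 0 \<le> c \<and> (\<forall>n. \<forall>f\<in>mpoly_vars n. gauss_norm (extend \<theta> f) \<le> c * gauss_norm f)}"

definition unit_ball_L :: "(dyadic_int mpoly \<Rightarrow> dyadic_int mpoly) set"
  where "unit_ball_L = {\<theta> \<in> carrier J2. norm_L \<theta> < 1}"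

section \<open>Reduction modulo 2\<close>

definition red :: "dyadic_int \<Rightarrow> bit"
  where "red c = of_int (residue c 1)"

text \<open>\<open>is_reduction \<phi>\<close>: \<open>\<phi>\<close> is the ring homomorphism with \<open>\<phi>(Jq\<^sup>k) = Sq\<^sup>k\<close> that reduces
  the coefficients. Its values outside \<open>carrier J2\<close> are irrelevant.\<close>

definition is_reduction ::
    "((dyadic_int mpoly \<Rightarrow> dyadic_int mpoly) \<Rightarrow> (bit mpoly \<Rightarrow> bit mpoly)) \<Rightarrow> bool"
  where "is_reduction \<phi> \<longleftrightarrow>
    \<phi> \<in> ring_hom J2 A2 \<and>
    (\<forall>k. \<phi> (Jq k) = Sq k) \<and>
    (\<forall>c. \<forall>\<theta>\<in>carrier J2. \<phi> (\<lambda>f. cst c * \<theta> f) = (\<lambda>g. cst (red c) * \<phi> \<theta> g))"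

text \<open>A map satisfying \<open>is_reduction\<close> exists and is unique on \<open>carrier J2\<close>.\<close>

lemma of_int_bit_mod_2: "(of_int (n mod 2) :: bit) = of_int n"
proof -
  have "(of_int n :: bit) = of_int (2 * (n div 2) + n mod 2)" by simp
  then show ?thesis by (simp only: of_int_add of_int_mult of_int_numeral bit_2_eq_0) simp
qed

lemma red_add: "red (a + b) = red a + red b"
  by (simp add: red_def plus_dyadic_int.rep_eq of_int_bit_mod_2)

lemma red_mult: "red (a * b) = red a * red b"
  by (simp add: red_def residue_mult of_int_bit_mod_2)

lemma red_0 [simp]: "red 0 = 0"
  by (simp add: red_def zero_dyadic_int.rep_eq)

lemma red_1 [simp]: "red 1 = 1"
  by (simp add: red_def one_dyadic_int.rep_eq)

definition red_poly :: "dyadic_int mpoly \<Rightarrow> bit mpoly"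
  where "red_poly f = Poly_Mapping.map red f"

lemma lookup_red_poly: "Poly_Mapping.lookup (red_poly f) m = red (Poly_Mapping.lookup f m)"
  by (simp add: red_poly_def Poly_Mapping.map.rep_eq when_def)

lemma red_poly_add: "red_poly (f + g) = red_poly f + red_poly g"
  by (rule poly_mapping_eqI) (simp add: lookup_red_poly lookup_add red_add)

lemma red_poly_0 [simp]: "red_poly 0 = 0"
  by (rule poly_mapping_eqI) (simp add: lookup_red_poly)

lemma red_poly_sum: "red_poly (\<Sum>x\<in>A. F x) = (\<Sum>x\<in>A. red_poly (F x))"
  by (induction A rule: infinite_finite_induct) (auto simp: red_poly_add)

lemma red_poly_single: "red_poly (Poly_Mapping.single m c) = Poly_Mapping.single m (red c)"
  by (rule poly_mapping_eqI) (simp add: lookup_red_poly lookup_single when_def)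

lemma red_poly_cst: "red_poly (cst c) = cst (red c)"
  by (simp add: cst_def red_poly_single)

lemma red_poly_1 [simp]: "red_poly 1 = 1"
  using red_poly_cst[of 1] by simp

lemma red_poly_xi: "red_poly (xi i) = xi i"
  by (simp add: xi_def red_poly_single)

lemma red_poly_mult: "red_poly (f * g) = red_poly f * red_poly g"
proof -
  have red_as_sum: "red_poly h =
      (\<Sum>m\<in>Poly_Mapping.keys h. Poly_Mapping.single m (red (Poly_Mapping.lookup h m)))" for h
    by (subst poly_as_sum[of h]) (simp only: red_poly_sum red_poly_single)
  have "f * g = (\<Sum>m\<in>Poly_Mapping.keys f. \<Sum>n\<in>Poly_Mapping.keys g.
      Poly_Mapping.single (m + n) (Poly_Mapping.lookup f m * Poly_Mapping.lookup g n))"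
    by (subst poly_as_sum[of f], subst poly_as_sum[of g])
       (simp add: sum_product mult_single)
  then have "red_poly (f * g) = (\<Sum>m\<in>Poly_Mapping.keys f. \<Sum>n\<in>Poly_Mapping.keys g.
      Poly_Mapping.single (m + n) (red (Poly_Mapping.lookup f m) * red (Poly_Mapping.lookup g n)))"
    by (simp only: red_poly_sum red_poly_single red_mult)
  then show ?thesis
    by (simp add: red_as_sum[of f] red_as_sum[of g] sum_product mult_single)
qed

lemma red_poly_power: "red_poly (f ^ n) = red_poly f ^ n"
  by (induction n) (simp_all add: red_poly_mult)

lemma red_poly_prod: "red_poly (\<Prod>x\<in>A. F x) = (\<Prod>x\<in>A. red_poly (F x))"
  by (induction A rule: infinite_finite_induct) (auto simp: red_poly_mult)

lemma red_poly_sq_mono: "red_poly (sq_mono m) = sq_mono m"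
  by (simp only: sq_mono_def red_poly_prod red_poly_power red_poly_add red_poly_xi)

lemma keys_red_poly: "Poly_Mapping.keys (red_poly f) \<subseteq> Poly_Mapping.keys f"
  by (auto simp: in_keys_iff lookup_red_poly)

lemma red_poly_total_sq: "red_poly (total_sq f) = total_sq (red_poly f)"
  unfolding sum_keys_superset[OF finite_keys keys_red_poly]
  by (simp only: total_sq_def red_poly_sum red_poly_mult red_poly_cst red_poly_sq_mono lookup_red_poly)

lemma red_poly_hom_part: "red_poly (hom_part d f) = hom_part d (red_poly f)"
  by (rule poly_mapping_eqI) (simp add: lookup_hom_part lookup_red_poly)

lemma red_poly_sq: "red_poly (sq k f) = sq k (red_poly f)"
proof -
  have "sq k (red_poly f) = (\<Sum>d\<in>mono_deg ` Poly_Mapping.keys f.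
      hom_part (d + k) (total_sq (hom_part d (red_poly f))))"
    using keys_red_poly[of f] by (intro sq_superset finite_imageI finite_keys image_mono)
  then show ?thesis
    by (simp only: sq_def red_poly_sum red_poly_total_sq red_poly_hom_part)
qed

lemma sq_ops_reduce: "\<theta> \<in> sq_ops \<Longrightarrow> \<exists>\<psi>\<in>sq_ops. \<forall>f. red_poly (\<theta> f) = \<psi> (red_poly f)"
proof (induction \<theta> rule: sq_ops.induct)
  case (sq k)
  show ?case by (rule bexI[of _ "sq k"]) (auto simp: red_poly_sq sq_ops.sq)
next
  case one
  show ?case by (rule bexI[of _ "\<lambda>f. f"]) (auto simp: sq_ops.one)
next
  case (scale \<theta> c)
  then obtain \<psi> where "\<psi> \<in> sq_ops" "\<forall>f. red_poly (\<theta> f) = \<psi> (red_poly f)" by blast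
  then show ?case
    by (intro bexI[of _ "\<lambda>g. cst (red c) * \<psi> g"])
       (auto simp: red_poly_mult red_poly_cst intro: sq_ops.scale)
next
  case (add \<theta> \<theta>')
  then obtain \<psi> \<psi>' where "\<psi> \<in> sq_ops" "\<forall>f. red_poly (\<theta> f) = \<psi> (red_poly f)"
    "\<psi>' \<in> sq_ops" "\<forall>f. red_poly (\<theta>' f) = \<psi>' (red_poly f)" by blast
  then show ?case
    by (intro bexI[of _ "\<lambda>g. \<psi> g + \<psi>' g"]) (auto simp: red_poly_add intro: sq_ops.add)
next
  case (comp \<theta> \<theta>')
  then obtain \<psi> \<psi>' where "\<psi> \<in> sq_ops" "\<forall>f. red_poly (\<theta> f) = \<psi> (red_poly f)"
    "\<psi>' \<in> sq_ops" "\<forall>f. red_poly (\<theta>' f) = \<psi>' (red_poly f)" by blast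
  then show ?case
    by (intro bexI[of _ "\<lambda>g. \<psi> (\<psi>' g)"]) (auto intro: sq_ops.comp)
qed

lemma red_poly_surj: "\<exists>f. red_poly f = g"
proof
  show "red_poly (Poly_Mapping.map (\<lambda>b. if b = 0 then 0 else 1) g) = g"
    by (rule poly_mapping_eqI)
       (simp add: lookup_red_poly Poly_Mapping.map.rep_eq when_def)
qed

lemma is_reduction_exists: "\<exists>\<phi>. is_reduction \<phi>"
proof -
  obtain \<phi> :: "(dyadic_int mpoly \<Rightarrow> dyadic_int mpoly) \<Rightarrow> (bit mpoly \<Rightarrow> bit mpoly)"
    where \<phi>: "\<And>\<theta>. \<theta> \<in> sq_ops \<Longrightarrow> \<phi> \<theta> \<in> sq_ops \<and> (\<forall>f. red_poly (\<theta> f) = \<phi> \<theta> (red_poly f))"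
    using bchoice[of sq_ops "\<lambda>\<theta> \<psi>. \<psi> \<in> sq_ops \<and> (\<forall>f. red_poly (\<theta> f) = \<psi> (red_poly f))"]
      sq_ops_reduce by blast
  have uniq: "\<phi> \<theta> = \<psi>" if "\<theta> \<in> sq_ops" "\<And>f. red_poly (\<theta> f) = \<psi> (red_poly f)" for \<theta> \<psi>
  proof
    fix g
    obtain f where "red_poly f = g" using red_poly_surj by blast
    then show "\<phi> \<theta> g = \<psi> g" using \<phi>[OF that(1)] that(2) by metis
  qed
  have "\<phi> \<in> ring_hom J2 A2"
  proof (rule ring_hom_memI)
    fix \<theta> assume "\<theta> \<in> carrier J2"
    then show "\<phi> \<theta> \<in> carrier A2" using \<phi> by (simp add: J2_def A2_def sq_algebra_def)
  next
    fix \<theta> \<psi> assume "\<theta> \<in> carrier J2" "\<psi> \<in> carrier J2"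
    then have *: "\<theta> \<in> sq_ops" "\<psi> \<in> sq_ops" by (auto simp: J2_def sq_algebra_def)
    note r = \<phi>[OF *(1)] \<phi>[OF *(2)]
    have "\<phi> (\<lambda>f. \<theta> (\<psi> f)) = (\<lambda>g. \<phi> \<theta> (\<phi> \<psi> g))"
      by (rule uniq, rule sq_ops.comp[OF *]) (simp only: r)
    then show "\<phi> (\<theta> \<otimes>\<^bsub>J2\<^esub> \<psi>) = \<phi> \<theta> \<otimes>\<^bsub>A2\<^esub> \<phi> \<psi>"
      by (simp add: J2_def A2_def sq_algebra_def)
    have "\<phi> (\<lambda>f. \<theta> f + \<psi> f) = (\<lambda>g. \<phi> \<theta> g + \<phi> \<psi> g)"
      by (rule uniq, rule sq_ops.add[OF *]) (simp only: r red_poly_add)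
    then show "\<phi> (\<theta> \<oplus>\<^bsub>J2\<^esub> \<psi>) = \<phi> \<theta> \<oplus>\<^bsub>A2\<^esub> \<phi> \<psi>"
      by (simp add: J2_def A2_def sq_algebra_def)
  next
    have "\<phi> (\<lambda>f. f) = (\<lambda>g. g)" by (rule uniq, rule sq_ops.one) simp
    then show "\<phi> \<one>\<^bsub>J2\<^esub> = \<one>\<^bsub>A2\<^esub>" by (simp add: J2_def A2_def sq_algebra_def)
  qed
  moreover have "\<phi> (Jq k) = Sq k" for k
    unfolding Jq_def Sq_def by (rule uniq, rule sq_ops.sq) (rule red_poly_sq)
  moreover have "\<phi> (\<lambda>f. cst c * \<theta> f) = (\<lambda>g. cst (red c) * \<phi> \<theta> g)" if "\<theta> \<in> carrier J2" for c \<theta>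
  proof -
    have *: "\<theta> \<in> sq_ops" using that by (simp add: J2_def sq_algebra_def)
    note r = \<phi>[OF *]
    show ?thesis by (rule uniq, rule sq_ops.scale[OF *]) (simp only: r red_poly_mult red_poly_cst)
  qed
  ultimately show ?thesis unfolding is_reduction_def by blast
qed

lemma is_reduction_unique:
  assumes "is_reduction \<phi>" "is_reduction \<phi>'" "\<theta> \<in> carrier J2"
  shows "\<phi> \<theta> = \<phi>' \<theta>"
proof -
  have hom: "\<phi> \<in> ring_hom J2 A2" "\<phi>' \<in> ring_hom J2 A2"
    using assms by (auto simp: is_reduction_def)
  have J2: "carrier J2 = sq_ops" by (simp add: J2_def sq_algebra_def)
  have "\<theta> \<in> sq_ops" using assms(3) J2 by simp
  then show ?thesis
  proof (induction \<theta> rule: sq_ops.induct)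
    case (sq k)
    show ?case using assms(1,2) unfolding is_reduction_def Jq_def by metis
  next
    case one
    show ?case using hom[THEN ring_hom_one] by (simp add: J2_def sq_algebra_def)
  next
    case (scale \<theta> c)
    then show ?case using assms(1,2) J2 by (simp add: is_reduction_def)
  next
    case (add \<theta> \<psi>)
    then show ?case
      using hom[THEN ring_hom_add, of \<theta> \<psi>] J2 by (simp add: J2_def A2_def sq_algebra_def)
  next
    case (comp \<theta> \<psi>)
    then show ?case
      using hom[THEN ring_hom_mult, of \<theta> \<psi>] J2 by (simp add: J2_def A2_def sq_algebra_def)
  qed
qed

end

(* An operator in J2 is integral on the monomial basis, so by the ultrametric inequality its norm
   is the largest absolute value of its matrix coefficients. These lie in the discrete set
   {0} \<union> {1, 1/2, 1/4, ...}, so the norm is less than 1 iff all of them are even,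
   that is, iff the reduced operator on polynomials over the field with two elements vanishes. *)

theory Submission
  imports Defs
begin

section \<open>Absolute value on the dyadic integers, through divisibility by powers of
  \<open>2\<close>\<close>

lemma dyadic_int_abs_le_power_iff: "dyadic_int_abs x \<le> (1 / 2) ^ n \<longleftrightarrow> 2 ^ n dvd x"
proof (cases "x = 0")
  case True
  then show ?thesis by (simp add: dyadic_int_abs_def)
next
  case False
  then obtain u where u: "x = 2 ^ dyadic_val x * u" "\<not> 2 dvd u"
    using dyadic_int_decomp by blast
  have "n \<le> dyadic_val x" if d: "2 ^ n dvd x"
  proof -
    obtain w where w: "x = 2 ^ n * w" using d by (rule dvdE)
    then have "w \<noteq> 0" using False by auto
    then obtain v where v: "w = 2 ^ dyadic_val w * v" "\<not> 2 dvd v"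
      using dyadic_int_decomp by blast
    \<comment> \<open>\<open>v(1)\<close> has \<open>w\<close> on both sides, so it is substituted
      once by hand instead of being used for rewriting.\<close>
    have "x = 2 ^ n * (2 ^ dyadic_val w * v)" using w v(1) by (rule subst[rotated])
    then have "x = 2 ^ (n + dyadic_val w) * v" by (simp only: power_add mult.assoc)
    then have "dyadic_val x = n + dyadic_val w" using dyadic_val_eqI[OF v(2)] by metis
    then show ?thesis by simp
  qed
  moreover have "2 ^ n dvd x" if "n \<le> dyadic_val x"
    using u(1) that by (metis dvd_triv_left dvd_trans le_imp_power_dvd)
  ultimately have "n \<le> dyadic_val x \<longleftrightarrow> 2 ^ n dvd x" by blast
  then show ?thesis using False by (simp add: dyadic_int_abs_def)
qed

lemma dyadic_int_abs_nonneg: "0 \<le> dyadic_int_abs x"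
  by (simp add: dyadic_int_abs_def)

lemma dyadic_int_abs_le_1: "dyadic_int_abs x \<le> 1"
  using dyadic_int_abs_le_power_iff[of x 0] by simp

lemma dyadic_int_abs_1: "dyadic_int_abs 1 = 1"
  using dyadic_int_abs_mult[of 1 1] dyadic_int_abs_eq_0_iff[of 1] by simp

text \<open>The value group is discrete: valuation \<open>0\<close> gives exactly \<open>1\<close>,
  and any other nonzero element has absolute value at most \<open>1 / 2\<close>.\<close>

lemma dyadic_int_abs_less_1_iff: "dyadic_int_abs x < 1 \<longleftrightarrow> 2 dvd x"
proof
  assume "dyadic_int_abs x < 1"
  then have "dyadic_int_abs x \<le> (1 / 2) ^ 1"
    by (cases "dyadic_val x") (auto simp: dyadic_int_abs_def power_le_one split: if_splits)
  then show "2 dvd x" unfolding dyadic_int_abs_le_power_iff by simp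
next
  assume "2 dvd x"
  then have "dyadic_int_abs x \<le> (1 / 2) ^ 1"
    unfolding dyadic_int_abs_le_power_iff by simp
  then show "dyadic_int_abs x < 1" by simp
qed

lemma dyadic_int_abs_add: "dyadic_int_abs (x + y) \<le> max (dyadic_int_abs x) (dyadic_int_abs y)"
proof (cases "x = 0 \<or> y = 0")
  case True
  then show ?thesis by auto
next
  case False
  define n where "n = min (dyadic_val x) (dyadic_val y)"
  \<comment> \<open>The smaller valuation belongs to the larger absolute value. The ultrametric
    inequality thereby becomes closure of the multiples of \<open>2 ^ n\<close> under
    addition.\<close>
  have max: "max (dyadic_int_abs x) (dyadic_int_abs y) = (1 / 2) ^ n"
    using False by (auto simp: dyadic_int_abs_def n_def max_def min_def)
  then have "2 ^ n dvd x" "2 ^ n dvd y"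
    by (simp_all flip: dyadic_int_abs_le_power_iff)
  then have "2 ^ n dvd x + y" by (rule dvd_add)
  then show ?thesis unfolding max dyadic_int_abs_le_power_iff .
qed

section \<open>Absolute value on the dyadic numbers\<close>

lemma dyadic_abs_0 [simp]: "dyadic_abs 0 = 0"
  using dyadic_abs_Fract[of 1 0] by (simp add: fract_collapse dyadic_int_abs_def)

lemma dyadic_abs_of_int: "dyadic_abs (Fraction_Field.Fract a 1) = dyadic_int_abs a"
  by (simp add: dyadic_abs_Fract dyadic_int_abs_1)

lemma dyadic_abs_nonneg: "0 \<le> dyadic_abs x"
  by (cases x) (simp add: dyadic_abs_Fract dyadic_int_abs_nonneg)

lemma dyadic_abs_mult: "dyadic_abs (x * y) = dyadic_abs x * dyadic_abs y"
  by (cases x; cases y) (simp add: dyadic_abs_Fract dyadic_int_abs_mult)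

text \<open>Over the common denominator \<open>b * d\<close> the integral inequality applies to the
  numerator \<open>a * d + c * b\<close>; dividing by the positive value of \<open>b * d\<close>
  finishes.\<close>

lemma dyadic_abs_add: "dyadic_abs (x + y) \<le> max (dyadic_abs x) (dyadic_abs y)"
proof -
  obtain a b where x: "x = Fraction_Field.Fract a b" "b \<noteq> 0" by (cases x) auto
  obtain c d where y: "y = Fraction_Field.Fract c d" "d \<noteq> 0" by (cases y) auto
  have pos: "0 < dyadic_int_abs b" "0 < dyadic_int_abs d"
    using x(2) y(2) by (simp_all add: dyadic_int_abs_def)
  have "dyadic_int_abs (a * d + c * b) \<le>
      max (dyadic_int_abs a * dyadic_int_abs d) (dyadic_int_abs c * dyadic_int_abs b)"
    using dyadic_int_abs_add[of "a * d" "c * b"] by (simp add: dyadic_int_abs_mult)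
  then show ?thesis
    using pos x(2) y(2) unfolding x(1) y(1)
    by (auto simp: dyadic_abs_Fract dyadic_int_abs_mult le_max_iff_disj field_simps)
qed

lemma dyadic_abs_sum_le:
  assumes "0 \<le> B" "\<And>x. x \<in> A \<Longrightarrow> dyadic_abs (F x) \<le> B"
  shows "dyadic_abs (sum F A) \<le> B"
  using assms(2)
proof (induction A rule: infinite_finite_induct)
  case (insert x A)
  then have "dyadic_abs (F x) \<le> B" "dyadic_abs (sum F A) \<le> B" by auto
  then show ?case
    using dyadic_abs_add[of "F x" "sum F A"] insert.hyps by simp
qed (simp_all add: assms(1))

section \<open>Gauss norm of polynomials\<close>

lemma gauss_norm_ge: "dyadic_abs (Poly_Mapping.lookup f m) \<le> gauss_norm f"
  \<comment> \<open>Off the support the coefficient is \<open>0\<close>, which is covered by the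
    \<open>0\<close> inserted into the set under \<open>Max\<close>.\<close>
  by (cases "m \<in> Poly_Mapping.keys f") (auto simp: gauss_norm_def in_keys_iff intro!: Max_ge)

lemma gauss_norm_le:
  assumes "0 \<le> B" "\<And>m. dyadic_abs (Poly_Mapping.lookup f m) \<le> B"
  shows "gauss_norm f \<le> B"
  unfolding gauss_norm_def using assms by (intro Max.boundedI) auto

lemma gauss_norm_nonneg: "0 \<le> gauss_norm f"
  using gauss_norm_ge dyadic_abs_nonneg order_trans by blast

lemma lookup_to_dyadic:
  "Poly_Mapping.lookup (to_dyadic f) m = Fraction_Field.Fract (Poly_Mapping.lookup f m) 1"
  by (simp add: to_dyadic_def Poly_Mapping.map.rep_eq when_def fract_collapse)

lemma gauss_norm_monomial: "gauss_norm (Poly_Mapping.single m 1) = 1"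
proof (rule antisym)
  have one: "dyadic_abs 1 = 1"
    using dyadic_abs_of_int[of 1] by (simp add: fract_collapse dyadic_int_abs_1)
  then show "1 \<le> gauss_norm (Poly_Mapping.single m 1)"
    using gauss_norm_ge[of "Poly_Mapping.single m 1" m] by simp
  show "gauss_norm (Poly_Mapping.single m 1) \<le> 1"
    by (rule gauss_norm_le) (auto simp: lookup_single when_def one)
qed

section \<open>Operator bounds from matrix coefficients\<close>

lemma extend_monomial:
  "extend \<theta> (Poly_Mapping.single m 1) = to_dyadic (\<theta> (Poly_Mapping.single m 1))"
  by (simp add: extend_def)

text \<open>Each coefficient of \<open>extend \<theta> f\<close> is a finite sum of products of a
  coefficient of \<open>f\<close> with a matrix entry. By the ultrametric inequality a bound on each
  product bounds the sum, with no factor for the number of terms.\<close>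

lemma gauss_norm_extend_le:
  assumes c: "0 \<le> c"
    and coeff: "\<And>m k. dyadic_int_abs (Poly_Mapping.lookup (\<theta> (Poly_Mapping.single m 1)) k) \<le> c"
  shows "gauss_norm (extend \<theta> f) \<le> c * gauss_norm f"
proof (rule gauss_norm_le)
  show B: "0 \<le> c * gauss_norm f" using c gauss_norm_nonneg by simp
  fix k
  show "dyadic_abs (Poly_Mapping.lookup (extend \<theta> f) k) \<le> c * gauss_norm f"
    unfolding extend_def lookup_sum
  proof (rule dyadic_abs_sum_le[OF B])
    fix m
    have "dyadic_abs (Poly_Mapping.lookup f m) *
        dyadic_int_abs (Poly_Mapping.lookup (\<theta> (Poly_Mapping.single m 1)) k) \<le> gauss_norm f * c"
      by (intro mult_mono gauss_norm_ge coeff gauss_norm_nonneg dyadic_int_abs_nonneg)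
    then show "dyadic_abs (Poly_Mapping.lookup (cst (Poly_Mapping.lookup f m) *
        to_dyadic (\<theta> (Poly_Mapping.single m 1))) k) \<le> c * gauss_norm f"
      by (simp add: lookup_cst_mult lookup_to_dyadic dyadic_abs_mult dyadic_abs_of_int mult.commute)
  qed
qed

lemma norm_L_less_1_iff:
  "norm_L \<theta> < 1 \<longleftrightarrow> (\<forall>m k. 2 dvd Poly_Mapping.lookup (\<theta> (Poly_Mapping.single m 1)) k)"
proof -
  define C where "C =
    {c. 0 \<le> c \<and> (\<forall>n. \<forall>f\<in>mpoly_vars n. gauss_norm (extend \<theta> f) \<le> c * gauss_norm f)}"
  have norm: "norm_L \<theta> = Inf C" by (simp add: norm_L_def C_def)
  \<comment> \<open>Matrix entries lie in the dyadic integers, so \<open>1\<close> is always a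
    bound; this makes the infimum one over a nonempty set.\<close>
  have "1 \<in> C"
    unfolding C_def using gauss_norm_extend_le[of 1 \<theta>] dyadic_int_abs_le_1 by simp
  then have ne: "C \<noteq> {}" by blast
  show ?thesis
  proof
    assume "norm_L \<theta> < 1"
    then obtain c where c: "c \<in> C" "c < 1" using cInf_lessD[OF ne] norm by auto
    show "\<forall>m k. 2 dvd Poly_Mapping.lookup (\<theta> (Poly_Mapping.single m 1)) k"
    proof (intro allI)
      fix m k
      obtain n where "(Poly_Mapping.single m 1 :: dyadic mpoly) \<in> mpoly_vars n"
        using mpoly_vars_exhaust by blast
      \<comment> \<open>Monomials have Gauss norm \<open>1\<close>, so testing on them bounds every
        matrix entry by \<open>c\<close>.\<close>
      then have "gauss_norm (extend \<theta> (Poly_Mapping.single m 1))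
          \<le> c * gauss_norm (Poly_Mapping.single m 1)"
        using c(1) unfolding C_def by blast
      then have "gauss_norm (to_dyadic (\<theta> (Poly_Mapping.single m 1))) < 1"
        using c(2) by (simp add: gauss_norm_monomial extend_monomial)
      then have "dyadic_int_abs (Poly_Mapping.lookup (\<theta> (Poly_Mapping.single m 1)) k) < 1"
        using gauss_norm_ge[of "to_dyadic (\<theta> (Poly_Mapping.single m 1))" k]
        by (simp add: lookup_to_dyadic dyadic_abs_of_int)
      then show "2 dvd Poly_Mapping.lookup (\<theta> (Poly_Mapping.single m 1)) k"
        by (simp only: dyadic_int_abs_less_1_iff)
    qed
  next
    assume even: "\<forall>m k. 2 dvd Poly_Mapping.lookup (\<theta> (Poly_Mapping.single m 1)) k"
    \<comment> \<open>There are infinitely many entries, and entrywise bounds below \<open>1\<close>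
      alone could let the supremum reach \<open>1\<close>. Discreteness supplies the uniform bound
      \<open>1 / 2\<close>.\<close>
    have "dyadic_int_abs (Poly_Mapping.lookup (\<theta> (Poly_Mapping.single m 1)) k) \<le> 1 / 2" for m k
      using even dyadic_int_abs_le_power_iff[of _ 1] by simp
    then have "1 / 2 \<in> C"
      unfolding C_def using gauss_norm_extend_le[of "1 / 2" \<theta>] by simp
    moreover have "bdd_below C" unfolding C_def by (rule bdd_belowI[of _ 0]) simp
    ultimately have "Inf C \<le> 1 / 2" by (rule cInf_lower)
    then show "norm_L \<theta> < 1" using norm by simp
  qed
qed

section \<open>Kernel of the reduction modulo 2\<close>

lemma red_eq_0_iff: "red c = 0 \<longleftrightarrow> 2 dvd c"
proof -
  have "residue c 1 = 0 \<or> residue c 1 = 1"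
    using mod2_eq_if[of "residue c 1"] residue_mod[of c 1] by (simp split: if_splits)
  then show ?thesis unfolding two_dvd_iff red_def by auto
qed

lemma red_poly_eq_0_iff: "red_poly f = 0 \<longleftrightarrow> (\<forall>k. 2 dvd Poly_Mapping.lookup f k)"
  by (simp add: poly_mapping_eq_iff fun_eq_iff lookup_red_poly red_eq_0_iff)

lemma sq_ops_sum: "\<theta> \<in> sq_ops \<Longrightarrow> \<theta> (sum F A) = (\<Sum>x\<in>A. \<theta> (F x))"
  \<comment> \<open>This instance yields \<open>\<theta> 0 = 0\<close>, needed for empty and for
    infinite \<open>A\<close>, where the sums are \<open>0\<close>.\<close>
  using sq_ops_cst_mult[of \<theta> 0 0]
  by (induction A rule: infinite_finite_induct) (auto simp: sq_ops_add)

lemma sq_ops_monomial_expansion: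
  assumes "\<theta> \<in> sq_ops"
  shows "\<theta> f = (\<Sum>m\<in>Poly_Mapping.keys f.
    cst (Poly_Mapping.lookup f m) * \<theta> (Poly_Mapping.single m 1))"
proof -
  have single: "\<theta> (Poly_Mapping.single m c) = cst c * \<theta> (Poly_Mapping.single m 1)" for m c
    using sq_ops_cst_mult[OF assms, of c "Poly_Mapping.single m 1"]
    by (simp add: cst_def mult_single)
  have "\<theta> f = (\<Sum>m\<in>Poly_Mapping.keys f.
      \<theta> (Poly_Mapping.single m (Poly_Mapping.lookup f m)))"
    by (subst poly_as_sum[of f]) (rule sq_ops_sum[OF assms])
  \<comment> \<open>The coefficient is fixed to the form \<open>lookup f _\<close>, since the
    general rule would also rewrite its own right-hand side.\<close>
  then show ?thesis by (simp only: single[of _ "Poly_Mapping.lookup f _"])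
qed

text \<open>\<open>is_reduction\<close> prescribes \<open>\<phi>\<close> only on generators and as a
  homomorphism. Induction over the generation of the algebra turns this into the action of
  \<open>\<phi> \<theta>\<close> on reduced polynomials.\<close>

lemma red_poly_reduction:
  assumes red: "is_reduction \<phi>" and "\<theta> \<in> sq_ops"
  shows "red_poly (\<theta> f) = \<phi> \<theta> (red_poly f)"
proof -
  have hom: "\<phi> \<in> ring_hom J2 A2" using red by (simp add: is_reduction_def)
  have J2: "carrier J2 = sq_ops" by (simp add: J2_def sq_algebra_def)
  show ?thesis
    using assms(2)
  proof (induction \<theta> arbitrary: f rule: sq_ops.induct)
    case (sq k)
    have "\<phi> (sq k) = sq k" using red unfolding is_reduction_def Jq_def Sq_def by blast
    then show ?case by (simp add: red_poly_sq)
  next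
    case one
    then show ?case using ring_hom_one[OF hom] by (simp add: J2_def A2_def sq_algebra_def)
  next
    case (scale \<theta> c)
    then show ?case
      using red J2 by (simp add: is_reduction_def red_poly_mult red_poly_cst)
  next
    case (add \<theta> \<psi>)
    then show ?case
      using ring_hom_add[OF hom, of \<theta> \<psi>] J2
      by (simp add: J2_def A2_def sq_algebra_def red_poly_add)
  next
    case (comp \<theta> \<psi>)
    then show ?case
      using ring_hom_mult[OF hom, of \<theta> \<psi>] J2 by (simp add: J2_def A2_def sq_algebra_def)
  qed
qed

lemma reduction_eq_0_iff:
  assumes "is_reduction \<phi>" "\<theta> \<in> sq_ops"
  shows "\<phi> \<theta> = (\<lambda>g. 0) \<longleftrightarrow> (\<forall>m. red_poly (\<theta> (Poly_Mapping.single m 1)) = 0)"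
proof
  assume "\<phi> \<theta> = (\<lambda>g. 0)"
  then show "\<forall>m. red_poly (\<theta> (Poly_Mapping.single m 1)) = 0"
    by (simp add: red_poly_reduction[OF assms])
next
  assume zero: "\<forall>m. red_poly (\<theta> (Poly_Mapping.single m 1)) = 0"
  show "\<phi> \<theta> = (\<lambda>g. 0)"
  proof
    fix g
    \<comment> \<open>Every polynomial over the two-element field lifts, so
      \<open>\<phi> \<theta>\<close> is determined by its values on reductions, and these by
      \<open>\<theta>\<close> on monomials.\<close>
    obtain f where "g = red_poly f" using red_poly_surj[of g] by blast
    then have "\<phi> \<theta> g = red_poly (\<theta> f)" by (simp only: red_poly_reduction[OF assms])
    also have "\<dots> = 0"
      by (subst sq_ops_monomial_expansion[OF assms(2)])
        (simp add: red_poly_sum red_poly_mult zero)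
    finally show "\<phi> \<theta> g = 0" .
  qed
qed

theorem theorem5p3:
  fixes \<phi> :: "(dyadic_int mpoly \<Rightarrow> dyadic_int mpoly) \<Rightarrow> (bit mpoly \<Rightarrow> bit mpoly)"
  assumes "is_reduction \<phi>"
  shows "unit_ball_L = a_kernel J2 A2 \<phi>"
proof -
  have "norm_L \<theta> < 1 \<longleftrightarrow> \<phi> \<theta> = \<zero>\<^bsub>A2\<^esub>" if "\<theta> \<in> carrier J2" for \<theta>
  proof -
    have "\<theta> \<in> sq_ops" using that by (simp add: J2_def sq_algebra_def)
    \<comment> \<open>Both conditions say that all matrix coefficients of \<open>\<theta>\<close>
      are even.\<close>
    then show ?thesis
      using reduction_eq_0_iff[OF assms]
      by (simp add: norm_L_less_1_iff red_poly_eq_0_iff A2_def sq_algebra_def)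
  qed
  then show ?thesis unfolding unit_ball_L_def a_kernel_def' by blast
qed

end
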